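(* Let $n$ be odd and $k=2$. Let $\rho\in\mathbb{F}_{2^n}\setminus\{0,1\}$, $\sigma=1+\rho$, and put $a=\rho^{1/6}$, $b=\sigma^{1/6}$ (so $a,b\notin\{0,1\}$ and $a^6+b^6=1$). Then $$Z(\rho)=2^{2n-3}\bigl(r(a,b)-1\bigr),\qquad r(a,b):=\#\bigl\{\tau\in\mathbb{F}_{2^n}:\ (a\tau^5+b)^3=(\tau^3+1)^5\bigr\}.$$ Moreover the map $\rho\mapsto(a,b)$ is a bijection from $\mathbb{F}_{2^n}\setminus\{0,1\}$ onto $\{(a,b)\in\mathbb{F}_{2^n}^2:\ a,b\notin\{0,1\},\ a^6+b^6=1\}$.
   Context: $\mathbb{F}_{2^n}$ is the field with $2^n$ elements ($n$ odd), $\operatorname{Tr}(x)=\sum_{i=0}^{n-1}x^{2^i}$ is the absolute trace, and $\chi(x)=(-1)^{\operatorname{Tr}(x)}$. For $n$ odd, $6$ is invertible modulo $2^n-1$, so $x\mapsto x^6$ is a bijection of $\mathbb{F}_{2^n}$, and $x^{1/6}$ denotes the image of $x$ under the inverse bijection. For $k=2$: $F(x)=x^{13}$, $\delta(b)=F(b)+F(b+1)+1$, $\Delta=\{\delta(b): b\in\mathbb{F}_{2^n}\}$, $S(c)=\sum_{t\in\Delta}\chi(ct)$, and for $\rho\notin\{0,1\}$, $\sigma=1+\rho$, $Z(\rho)=\sum_{\lambda\in\mathbb{F}_{2^n}^{*}}S(\lambda)S(\lambda\rho)S(\lambda\sigma)$. *)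

theory Defs
  imports Main "HOL-Library.Cardinality"
begin

text \<open>The field with \<open>2 ^ n\<close> elements is modelled by a type \<open>'a :: {field, finite}\<close>
  with \<open>CARD('a) = 2 ^ n\<close>; \<open>n\<close> is passed explicitly where the trace is involved.\<close>

definition Tr :: "nat \<Rightarrow> 'a :: {field, finite} \<Rightarrow> 'a" where
  "Tr n x = (\<Sum>i<n. x ^ (2 ^ i))"

text \<open>The trace takes its values in the prime field \<open>{0, 1}\<close>, so the case distinction
  below is \<open>(-1) ^ Tr x\<close>.\<close>

definition chi :: "nat \<Rightarrow> 'a :: {field, finite} \<Rightarrow> int" where
  "chi n x = (if Tr n x = 0 then 1 else - 1)"

text \<open>Inverse of the sixth power map, which is a bijection of the field with \<open>2 ^ n\<close>
  elements for odd \<open>n\<close>; the value of \<open>inv\<close> is unspecified off the range of a map.\<close>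

definition root6 :: "'a :: {field, finite} \<Rightarrow> 'a" where
  "root6 = inv (\<lambda>x. x ^ 6)"

definition F :: "'a :: {field, finite} \<Rightarrow> 'a" where
  "F x = x ^ 13"

definition delta :: "'a :: {field, finite} \<Rightarrow> 'a" where
  "delta b = F b + F (b + 1) + 1"

definition Delta :: "'a :: {field, finite} set" where
  "Delta = range delta"

definition S :: "nat \<Rightarrow> 'a :: {field, finite} \<Rightarrow> int" where
  "S n c = (\<Sum>t\<in>Delta. chi n (c * t))"

definition Z :: "nat \<Rightarrow> 'a :: {field, finite} \<Rightarrow> int" where
  "Z n \<rho> = (\<Sum>l\<in>UNIV - {0}. S n l * S n (l * \<rho>) * S n (l * (1 + \<rho>)))"

definition r :: "'a :: {field, finite} \<Rightarrow> 'a \<Rightarrow> nat" where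
  "r a b = card {\<tau>. (a * \<tau> ^ 5 + b) ^ 3 = (\<tau> ^ 3 + 1) ^ 5}"

end

theory Submission
  imports Defs "HOL-Computational_Algebra.Primes"
begin

text \<open>
  Since \<open>b ^ 13 + (b + 1) ^ 13 + 1 = u ^ 6 + u ^ 5\<close> for \<open>u = b\<^sup>2 + b + 1\<close>, and \<open>b\<^sup>2 + b + 1\<close> runs
  through the elements of trace one, a sum over the image of \<open>delta\<close> is a sum over those \<open>u\<close>. For
  \<open>c = m ^ 6\<close> with \<open>m\<close> nonzero, substituting \<open>x = m u\<close> and using that the trace is invariant under
  squaring turns \<open>2 S(c)\<close> into \<open>W(m) - G\<close>, where \<open>W(m)\<close> is the sum of \<open>\<chi>(x\<^sup>3 + m x ^ 5)\<close> over all
  \<open>x\<close>, and \<open>G\<close> the sum of \<open>\<chi>(c (u ^ 6 + u ^ 5) + u)\<close> over all \<open>u\<close>.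

  The sum \<open>G\<close> vanishes. Its exponent is equivalent to a quadratic form, so \<open>G\<^sup>2\<close> is \<open>2 ^ n\<close> times
  the sum of \<open>\<chi>\<close> of the form over its radical. The radical is nontrivial, because \<open>2 ^ n\<close> is not a
  square, and its equation factors explicitly; this exhibits a radical element at which the form has
  trace one, and translation by it changes the sign of \<open>G\<close>.

  Hence \<open>8 Z(\<rho>)\<close> is the sum of \<open>W(m) W(m a) W(m b)\<close> over all \<open>m\<close>. By orthogonality this is \<open>2 ^ n\<close>
  times the sum of \<open>\<chi>(z\<^sup>3 + x\<^sup>3 + y\<^sup>3)\<close> over the cone \<open>z ^ 5 + a x ^ 5 + b y ^ 5 = 0\<close>. Scaling
  reduces that to counting the lines of the cone on which \<open>z\<^sup>3 + x\<^sup>3 + y\<^sup>3 = 0\<close>; with \<open>y = 1\<close> and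
  \<open>x = \<tau>\<close> they correspond to the solutions counted by \<open>r a b\<close>.
\<close>

section \<open>Power maps on a finite field\<close>

lemma power_card_minus_one:
  fixes x :: "'a :: {field, finite}"
  assumes "x \<noteq> 0"
  shows "x ^ (CARD('a) - 1) = 1"
proof -
  have "bij_betw (\<lambda>y. x * y) (UNIV - {0}) (UNIV - {0})"
    by (rule bij_betw_byWitness[where f' = "\<lambda>y. y / x"]) (use assms in auto)
  from prod.reindex_bij_betw[OF this, of "\<lambda>y. y"]
  have "(\<Prod>y\<in>UNIV - {0}. y) = x ^ (CARD('a) - 1) * (\<Prod>y\<in>UNIV - {0}. y)"
    by (simp add: prod.distrib card_Diff_singleton)
  moreover have "(\<Prod>y\<in>UNIV - {0::'a}. y) \<noteq> 0" by simp
  ultimately show ?thesis by simp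
qed

text \<open>A Bezout relation gives an \<open>i\<close> with \<open>z ^ (k * i) = z\<close> for
  nonzero \<open>z\<close>, so the power map can be undone.\<close>

lemma inj_power_coprime:
  assumes "coprime k (CARD('a :: {field, finite}) - 1)" and "k > 0"
  shows "inj (\<lambda>x :: 'a. x ^ k)"
proof (rule injI)
  fix x y :: 'a
  assume eq: "x ^ k = y ^ k"
  obtain i j where ij: "k * i = (CARD('a) - 1) * j + 1"
    using bezout_nat[of k "CARD('a) - 1"] assms by (auto simp: coprime_iff_gcd_eq_1)
  have pow: "z ^ (k * i) = z" if "z \<noteq> 0" for z :: 'a
    using power_card_minus_one[OF that] by (simp add: ij power_add power_mult)
  show "x = y"
  proof (cases "x = 0 \<or> y = 0")
    case True
    then show ?thesis using eq assms(2) by (auto simp: power_0_left)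
  next
    case False
    then have "x = (x ^ k) ^ i" "y = (y ^ k) ^ i" using pow by (metis power_mult)+
    then show ?thesis using eq by simp
  qed
qed

section \<open>Characteristic two, the trace and its additive character\<close>

locale odd_binary_field =
  fixes n :: nat and field_type :: "'a :: {field, finite} itself"
  assumes card_eq: "CARD('a) = 2 ^ n" and odd_n: "odd n"
begin

lemma n_pos: "n > 0"
  using odd_n by (cases n) auto

lemma power_card [simp]: "(x :: 'a) ^ (2 ^ n) = x"
proof (cases "x = 0")
  case False
  have "x ^ (2 ^ n) = x * x ^ (CARD('a) - 1)" by (simp add: card_eq flip: power_Suc)
  then show ?thesis using power_card_minus_one[OF False] by simp
qed simp

lemma minus_one: "- 1 = (1 :: 'a)"
proof -
  have "(- 1) ^ (2 ^ n) = (1 :: 'a)" using n_pos by (intro neg_one_even_power) simp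
  then show ?thesis using power_card[of "- 1"] by metis
qed

lemma minus_eq [simp]: "- x = (x :: 'a)"
  using minus_one by (metis mult.left_neutral mult_minus_left)

lemma add_self [simp]: "x + x = (0 :: 'a)"
  using minus_eq[of x] by (metis add.right_inverse)

lemma add_self_left [simp]: "x + (x + y) = (y :: 'a)"
  by (simp flip: add.assoc)

lemma numeral_Bit0_eq [simp]: "numeral (num.Bit0 k) = (0 :: 'a)"
  by (simp only: numeral_Bit0 add_self)

lemma numeral_Bit1_eq [simp]: "numeral (num.Bit1 k) = (1 :: 'a)"
  by (simp only: numeral_Bit1 add_self add_0)

lemma add_eq_0_iff_eq: "x + y = 0 \<longleftrightarrow> x = (y :: 'a)"
  using add_eq_0_iff[of x y] by auto

lemma add_eq_iff: "x + y = z \<longleftrightarrow> x = z + (y :: 'a)"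
  by (auto simp: add.assoc)

lemma power2_add: "(x + y :: 'a) ^ 2 = x ^ 2 + y ^ 2"
  by (simp add: power2_sum)

lemma power2_power_add: "(x + y :: 'a) ^ (2 ^ i) = x ^ (2 ^ i) + y ^ (2 ^ i)"
proof (induction i)
  case (Suc i)
  then show ?case
    by (simp only: power_Suc2 power_mult power2_add)
qed simp

text \<open>For odd \<open>n\<close>, \<open>2 ^ n\<close> is 2 modulo 3 and 2 or 3 modulo 5, so the
  odd number \<open>2 ^ n - 1\<close> is divisible by neither 3 nor 5.\<close>

lemma inj_power:
  assumes "k \<in> {3, 4, 5, 6}"
  shows "inj (\<lambda>x :: 'a. x ^ k)"
proof (rule inj_power_coprime)
  obtain m where m: "n = 2 * m + 1" using odd_n by (elim oddE)
  have "\<exists>j. (2 :: nat) ^ n = 3 * j + 2" unfolding m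
  proof (induction m)
    case 0
    show ?case by (intro exI[of _ 0]) simp
  next
    case (Suc m)
    then obtain j where "(2 :: nat) ^ (2 * m + 1) = 3 * j + 2" ..
    then show ?case by (intro exI[of _ "4 * j + 2"]) simp
  qed
  then have "\<not> 3 dvd (2 :: nat) ^ n - 1" by (auto simp: dvd_def, arith)
  then have c3: "coprime 3 ((2 :: nat) ^ n - 1)"
    by (intro prime_imp_coprime) simp_all
  have "\<exists>j. (2 :: nat) ^ n = 5 * j + 2 \<or> (2 :: nat) ^ n = 5 * j + 3" unfolding m
  proof (induction m)
    case 0
    show ?case by (intro exI[of _ 0]) simp
  next
    case (Suc m)
    then obtain j where "(2 :: nat) ^ (2 * m + 1) = 5 * j + 2 \<or> (2 :: nat) ^ (2 * m + 1) = 5 * j + 3" ..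
    then show ?case
      by (elim disjE) (rule exI[of _ "4 * j + 1"], simp, rule exI[of _ "4 * j + 2"], simp)
  qed
  then have "\<not> 5 dvd (2 :: nat) ^ n - 1" by (auto simp: dvd_def, arith+)
  then have c5: "coprime 5 ((2 :: nat) ^ n - 1)"
    by (intro prime_imp_coprime) simp_all
  have c2: "coprime 2 ((2 :: nat) ^ n - 1)"
    using n_pos by (simp add: coprime_left_2_iff_odd)
  have "coprime (2 * 2) ((2 :: nat) ^ n - 1)" "coprime (2 * 3) ((2 :: nat) ^ n - 1)"
    using c2 c3 by (simp_all only: coprime_mult_left_iff)
  then show "coprime k (CARD('a) - 1)"
    using assms c3 c5 by (auto simp: card_eq)
qed (use assms in auto)

lemma bij_power: "k \<in> {3, 4, 5, 6} \<Longrightarrow> bij (\<lambda>x :: 'a. x ^ k)"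
  by (simp add: inj_power finite_UNIV_inj_surj bij_def)

lemma power_eq_iff: "k \<in> {3, 4, 5, 6} \<Longrightarrow> x ^ k = y ^ k \<longleftrightarrow> x = (y :: 'a)"
  using inj_power by (auto dest: injD)

lemma Tr_add: "Tr n (x + y :: 'a) = Tr n x + Tr n y"
  by (simp add: Tr_def power2_power_add sum.distrib)

lemma Tr_square: "Tr n (x ^ 2 :: 'a) = Tr n x"
proof -
  have "Tr n (x ^ 2) = (\<Sum>i<n. x ^ (2 ^ Suc i))"
    by (simp add: Tr_def power_mult)
  also have "\<dots> + x = (\<Sum>i<Suc n. x ^ (2 ^ i))"
    by (subst sum.lessThan_Suc_shift) simp
  also have "\<dots> = Tr n x + x" by (simp add: Tr_def)
  finally show ?thesis by simp
qed

lemma power2_sum_distrib: "(\<Sum>i\<in>A. f i :: 'a) ^ 2 = (\<Sum>i\<in>A. f i ^ 2)"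
  by (induction A rule: infinite_finite_induct) (auto simp: power2_add)

lemma Tr_cases: "Tr n (x :: 'a) = 0 \<or> Tr n x = 1"
proof -
  have "Tr n x ^ 2 = Tr n (x ^ 2)"
    by (simp add: Tr_def power2_sum_distrib flip: power_mult) (simp add: mult.commute)
  then have "Tr n x * Tr n x = Tr n x" by (simp only: Tr_square flip: power2_eq_square)
  then show ?thesis by auto
qed

lemma Tr_1: "Tr n (1 :: 'a) = 1"
proof -
  obtain m where "n = 2 * m + 1" using odd_n by (elim oddE)
  then show ?thesis by (simp add: Tr_def)
qed

lemma chi_add: "chi n (x + y :: 'a) = chi n x * chi n y"
  using Tr_cases[of x] Tr_cases[of y] by (auto simp: chi_def Tr_add)

lemma chi_square: "chi n (x ^ 2 :: 'a) = chi n x"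
  by (simp add: chi_def Tr_square)

lemma chi_0 [simp]: "chi n (0 :: 'a) = 1"
  using n_pos by (simp add: chi_def Tr_def power_0_left)

lemma chi_1 [simp]: "chi n (1 :: 'a) = - 1"
  by (simp add: chi_def Tr_1)

lemma chi_cases: "chi n (x :: 'a) = 1 \<or> chi n x = - 1"
  by (simp add: chi_def)

lemma chi_mult_self [simp]: "chi n (x :: 'a) * chi n x = 1"
  by (simp add: chi_def)

lemma sum_translate: "(\<Sum>x\<in>UNIV. f (x + y :: 'a)) = (\<Sum>x\<in>UNIV. f x)"
  by (rule sum.reindex_bij_witness[of _ "\<lambda>x. x + y" "\<lambda>x. x + y"]) (auto simp: add.assoc)

lemma sum_power: "k \<in> {3, 4, 5, 6} \<Longrightarrow> (\<Sum>x\<in>UNIV. f (x ^ k :: 'a)) = (\<Sum>x\<in>UNIV. f x)"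
  using sum.reindex_bij_betw[OF bij_power] by simp

lemma sum_scale: "s \<noteq> 0 \<Longrightarrow> (\<Sum>x\<in>UNIV. f (s * x :: 'a)) = (\<Sum>x\<in>UNIV. f x)"
  by (rule sum.reindex_bij_witness[of _ "\<lambda>x. x / s" "\<lambda>x. s * x"]) auto

lemma sum_eq_0_if_antiperiodic:
  assumes "\<And>x. f (x + w :: 'a) = - f x"
  shows "(\<Sum>x\<in>UNIV. f x) = (0 :: int)"
  using sum_translate[of f w] assms by (simp add: sum_negf)

lemma sum_chi_mult: "(\<Sum>x\<in>UNIV. chi n (x * d :: 'a)) = (if d = 0 then 2 ^ n else 0)"
proof (cases "d = 0")
  case False
  then have "(\<Sum>x\<in>UNIV. chi n (x * d)) = 0"
    by (intro sum_eq_0_if_antiperiodic[of _ "1 / d"]) (simp add: distrib_right chi_add)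
  with False show ?thesis by simp
qed (simp add: card_eq)

lemma sum_chi_mult_power:
  "k \<in> {3, 4, 5, 6} \<Longrightarrow> (\<Sum>x\<in>UNIV. chi n (x ^ k * d :: 'a)) = (if d = 0 then 2 ^ n else 0)"
  using sum_power[of k "\<lambda>x. chi n (x * d)"] by (simp add: sum_chi_mult)

lemma artin_schreier_solvable:
  assumes "chi n (x :: 'a) = 1"
  obtains e where "e ^ 2 + e = x"
proof -
  obtain m where m: "n = 2 * m + 1" using odd_n by (elim oddE)
  \<comment> \<open>the half trace\<close>
  define h where "h = (\<lambda>k. \<Sum>i\<le>k. x ^ (2 ^ (2 * i)))"
  have "h k ^ 2 + h k = (\<Sum>i<2 * k + 2. x ^ (2 ^ i))" for k
  proof (induction k)
    case 0
    then show ?case by (simp add: h_def numeral_2_eq_2)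
  next
    case (Suc k)
    have "h (Suc k) ^ 2 + h (Suc k) = (h k ^ 2 + h k) + ((x ^ (2 ^ (2 * Suc k))) ^ 2 + x ^ (2 ^ (2 * Suc k)))"
      by (simp add: h_def power2_add add_ac)
    also have "(x ^ (2 ^ (2 * Suc k))) ^ 2 = x ^ (2 ^ (2 * k + 3))"
      by (simp add: numeral_3_eq_3 mult.commute flip: power_mult)
    finally show ?case using Suc by (simp add: add_ac numeral_3_eq_3)
  qed
  \<comment> \<open>For \<open>k = m\<close> the sum has \<open>n + 1\<close> terms; the surplus
    last one is \<open>x ^ (2 ^ n) = x\<close>.\<close>
  from this[of m] have "h m ^ 2 + h m = (\<Sum>i<Suc n. x ^ (2 ^ i))"
    by (simp add: m)
  then have "h m ^ 2 + h m = Tr n x + x"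
    by (simp add: Tr_def)
  moreover have "Tr n x = 0" using assms by (auto simp: chi_def split: if_splits)
  ultimately show ?thesis using that by simp
qed

subsection \<open>The vanishing quadratic sum\<close>

text \<open>Descent: \<open>g\<close> must be even, and halving it removes a factor 4, down to
  \<open>g ^ 2 = 2\<close>.\<close>

lemma not_square:
  fixes g :: int
  shows "g ^ 2 \<noteq> 2 ^ n"
proof -
  have "g ^ 2 \<noteq> 2 * 4 ^ m" for m
  proof (induction m arbitrary: g)
    case 0
    show ?case
    proof
      assume eq: "g ^ 2 = 2 * 4 ^ 0"
      then have "even (g ^ 2)" by simp
      then obtain k where "g = 2 * k" by auto
      with eq have "2 * k ^ 2 = 1" by (simp add: power_mult_distrib)
      then show False by (metis dvd_triv_left odd_one)
    qed
  next
    case (Suc m)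
    show ?case
    proof
      assume eq: "g ^ 2 = 2 * 4 ^ Suc m"
      then have "even (g ^ 2)" by simp
      then obtain k where "g = 2 * k" by auto
      with eq have "k ^ 2 = 2 * 4 ^ m" by (simp add: power_mult_distrib)
      with Suc show False by blast
    qed
  qed
  moreover obtain m where "n = 2 * m + 1" using odd_n by (elim oddE)
  ultimately show ?thesis by (simp add: power_mult)
qed

definition quad :: "'a \<Rightarrow> 'a \<Rightarrow> 'a" where
  "quad c u = c * (u ^ 6 + u ^ 5) + u"

text \<open>The trace of \<open>quad c\<close> has as polar form the trace of
  \<open>u ^ 4 * radical_poly c w\<close>, so the zeros \<open>w\<close> make up its
  radical.\<close>

definition radical_poly :: "'a \<Rightarrow> 'a \<Rightarrow> 'a" where
  "radical_poly c w = c * (w ^ 2 + w) + c ^ 2 * w ^ 8 + c ^ 4 * w ^ 16"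

text \<open>The cross terms of \<open>u ^ 6\<close> and \<open>u ^ 5\<close> are biadditive;
  squaring those in \<open>u ^ 2\<close> and \<open>u\<close> under the trace gives all of them the
  factor \<open>u ^ 4\<close>.\<close>

lemma chi_quad_add:
  "chi n (quad c (u + w)) = chi n (quad c u) * chi n (quad c w) * chi n (u ^ 4 * radical_poly c w)"
proof -
  have "quad c (u + w) = quad c u + quad c w
      + (c * u ^ 4 * w ^ 2 + c * u ^ 2 * w ^ 4 + c * u ^ 4 * w + c * u * w ^ 4)"
    unfolding quad_def by (simp add: algebra_simps numeral_eq_Suc)
  then have "chi n (quad c (u + w)) = chi n (quad c u) * chi n (quad c w)
      * (chi n (c * u ^ 4 * w ^ 2) * chi n (c * u ^ 2 * w ^ 4) * chi n (c * u ^ 4 * w)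
        * chi n (c * u * w ^ 4))"
    by (simp add: chi_add)
  also have "chi n (c * u ^ 2 * w ^ 4) = chi n (c ^ 2 * u ^ 4 * w ^ 8)"
    using chi_square[of "c * u ^ 2 * w ^ 4"] by (simp add: power_mult_distrib flip: power_mult)
  also have "chi n (c * u * w ^ 4) = chi n (c ^ 4 * u ^ 4 * w ^ 16)"
    using chi_square[of "c * u * w ^ 4"] chi_square[of "(c * u * w ^ 4) ^ 2"]
    by (simp add: power_mult_distrib flip: power_mult)
  finally show ?thesis
    by (simp add: radical_poly_def algebra_simps flip: chi_add)
qed

text \<open>The left side is \<open>p ^ 2 * w ^ 2 + p * w + p ^ 4 + p\<close>, a quadratic in
  \<open>w\<close> which for nonzero \<open>p\<close> has the roots \<open>p + 1\<close> and
  \<open>p + 1 + 1 / p\<close>.\<close>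

lemma radical_poly_factor:
  assumes "p = c * w ^ 5"
  shows "radical_poly c w * w ^ 4 = p * (w + p + 1) * (p * w + p ^ 2 + p + 1)"
  unfolding radical_poly_def assms by (simp add: algebra_simps numeral_eq_Suc)

lemma sum_chi_quad_square:
  "(\<Sum>u\<in>UNIV. chi n (quad c u)) ^ 2
    = (\<Sum>w\<in>UNIV. chi n (quad c w) * (if radical_poly c w = 0 then 2 ^ n else 0))"
proof -
  have "(\<Sum>u\<in>UNIV. chi n (quad c u)) ^ 2
      = (\<Sum>u\<in>UNIV. chi n (quad c u) * (\<Sum>w\<in>UNIV. chi n (quad c w)))"
    by (simp add: power2_eq_square sum_distrib_right)
  also have "\<dots> = (\<Sum>u\<in>UNIV. \<Sum>w\<in>UNIV. chi n (quad c u) * chi n (quad c (u + w)))"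
    using sum_translate[of "\<lambda>w. chi n (quad c w)"] by (simp add: sum_distrib_left[symmetric] add.commute)
  also have "\<dots> = (\<Sum>w\<in>UNIV. \<Sum>u\<in>UNIV. chi n (quad c u) * chi n (quad c (u + w)))"
    by (rule sum.swap)
  also have "\<dots> = (\<Sum>w\<in>UNIV. chi n (quad c w) * (\<Sum>u\<in>UNIV. chi n (u ^ 4 * radical_poly c w)))"
  proof (intro sum.cong refl)
    fix w
    have "chi n (quad c u) * chi n (quad c (u + w)) = chi n (quad c w) * chi n (u ^ 4 * radical_poly c w)" for u
      using chi_cases[of "quad c u"] by (auto simp: chi_quad_add)
    then show "(\<Sum>u\<in>UNIV. chi n (quad c u) * chi n (quad c (u + w)))
        = chi n (quad c w) * (\<Sum>u\<in>UNIV. chi n (u ^ 4 * radical_poly c w))"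
      by (simp add: sum_distrib_left)
  qed
  finally show ?thesis by (simp add: sum_chi_mult_power)
qed

lemma radical_poly_nontrivial_root:
  obtains w where "w \<noteq> 0" "radical_poly c w = 0"
proof (rule ccontr)
  assume no_root: "\<not> thesis"
  have "radical_poly c w = 0 \<longleftrightarrow> w = 0" for w
  proof
    show "radical_poly c w = 0 \<Longrightarrow> w = 0" using no_root that by blast
  qed (simp add: radical_poly_def)
  then have "(\<Sum>u\<in>UNIV. chi n (quad c u)) ^ 2
      = (\<Sum>w\<in>UNIV. if w = 0 then 2 ^ n * chi n (quad c w) else 0)"
    unfolding sum_chi_quad_square by (intro sum.cong) simp_all
  also have "\<dots> = 2 ^ n * chi n (quad c 0)" by (rule sum.delta[THEN trans]) simp_all
  also have "\<dots> = 2 ^ n" by (simp add: quad_def)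
  finally show False using not_square by blast
qed

lemma radical_poly_odd_root:
  assumes "c \<noteq> 0"
  obtains w where "radical_poly c w = 0" "chi n (quad c w) = - 1"
proof -
  note witness = that
  \<comment> \<open>Here \<open>p = c * w ^ 5\<close> is \<open>w + 1\<close>, so
    \<open>quad c w = p * w + p + w\<close> becomes \<open>w ^ 2 + w + 1\<close>, which has the
    trace of 1.\<close>
  have first_branch: thesis if w: "w \<noteq> 0" "c * w ^ 5 = w + 1" for w
  proof (rule witness)
    show "radical_poly c w = 0"
      using radical_poly_factor[OF w(2)[symmetric]] w(1) by (simp add: add_ac)
    have "quad c w = (w + 1) * w + (w + 1) + w"
      unfolding w(2)[symmetric] by (simp add: quad_def algebra_simps numeral_eq_Suc)
    also have "\<dots> = (w ^ 2 + w) + 1" by (simp add: algebra_simps power2_eq_square)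
    finally show "chi n (quad c w) = - 1" by (simp add: chi_add chi_square)
  qed
  obtain w where w: "w \<noteq> 0" "radical_poly c w = 0"
    by (rule radical_poly_nontrivial_root)
  define p where "p = c * w ^ 5"
  have p0: "p \<noteq> 0" using assms w by (simp add: p_def)
  have "w + p + 1 = 0 \<or> p * w + p ^ 2 + p + 1 = 0"
    using radical_poly_factor[OF p_def] w p0 by simp
  then have "w + p + 1 = 0 \<or> p * w + (p ^ 2 + p + 1) = 0" by (simp add: add_ac)
  then have "w + p = 1 \<or> p * w = p ^ 2 + p + 1" by (simp only: add_eq_0_iff_eq)
  then have "w = p + 1 \<or> p * w = p ^ 2 + p + 1" by (metis add_eq_iff add.commute)
  then have "p = w + 1 \<or> p * w = p ^ 2 + p + 1" by (auto simp: add.assoc)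
  then consider "p = w + 1" | "p * w = p ^ 2 + p + 1" by blast
  then show thesis
  proof cases
    case 1
    then show thesis using first_branch w(1) by (simp add: p_def)
  next
    case 2
    \<comment> \<open>On this branch \<open>quad c w\<close> has the trace of \<open>1 / p\<close>.
      If that is one, \<open>w\<close> itself serves; otherwise \<open>1 / p = e ^ 2 + e\<close>
      leads to another root.\<close>
    have wp: "w = p + 1 + 1 / p" using 2 p0 by (simp add: field_simps power2_eq_square)
    have "quad c w = p * w + p + w" by (simp add: quad_def p_def algebra_simps power_numeral_reduce)
    also have "\<dots> = (p ^ 2 + p) + 1 / p" by (simp add: 2) (simp add: wp add_ac)
    finally have chi_w: "chi n (quad c w) = chi n (1 / p)" by (simp add: chi_add chi_square)
    show thesis
    proof (cases "chi n (1 / p) = 1")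
      case False
      then show thesis using that w chi_w chi_cases by metis
    next
      case True
      then obtain e where e: "e ^ 2 + e = 1 / p" by (rule artin_schreier_solvable)
      \<comment> \<open>\<open>d / e\<close> is a second radical element, lying on the first branch of the factorisation\<close>
      define d where "d = e ^ 4 + e + 1"
      have pe: "p * (e ^ 2 + e) = 1" using e p0 by simp
      have e0: "e \<noteq> 0" using pe by auto
      \<comment> \<open>The choice of \<open>d\<close> is
        \<open>w / p = 1 + 1 / p + 1 / p ^ 2\<close> written in terms of \<open>e\<close>.\<close>
      have "p * (p * d) = (p * (e ^ 2 + e)) ^ 2 + p * (p * (e ^ 2 + e)) + p ^ 2"
        unfolding d_def by (simp add: algebra_simps numeral_eq_Suc)
      then have "p * (p * d) = p * w" unfolding pe 2 by (simp add: add_ac)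
      then have w_eq: "w = p * d" using p0 by simp
      then have d0: "d \<noteq> 0" using w by auto
      have "p * (c * d ^ 5 * p ^ 4) = c * (p * d) ^ 5"
        by (simp add: algebra_simps numeral_eq_Suc)
      also have "\<dots> = p" by (simp only: p_def[symmetric] w_eq[symmetric])
      finally have "c * d ^ 5 * p ^ 4 = 1" using p0 by simp
      moreover have "p ^ 4 * (e ^ 2 + e) ^ 4 = 1" by (simp add: pe flip: power_mult_distrib)
      \<comment> \<open>Both sides are \<open>1 / p ^ 4\<close>. As
        \<open>d + e = e ^ 4 + 1\<close>, the right side is also \<open>e ^ 4 * (d + e)\<close>, and
        dividing by \<open>e ^ 5\<close> gives the first-branch equation.\<close>
      ultimately have "c * d ^ 5 = (e ^ 2 + e) ^ 4"
        using p0 by (metis mult.commute mult_cancel_right power_not_zero)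
      also have "\<dots> = (d / e + 1) * e ^ 5"
        using e0 unfolding d_def by (simp add: field_simps numeral_eq_Suc)
      finally have "c * (d / e) ^ 5 = d / e + 1" using e0 by (simp add: power_divide)
      then show thesis using d0 e0 by (intro first_branch[of "d / e"]) auto
    qed
  qed
qed

lemma sum_chi_quad_eq_0:
  assumes "c \<noteq> 0"
  shows "(\<Sum>u\<in>UNIV. chi n (quad c u)) = 0"
proof -
  obtain w where "radical_poly c w = 0" "chi n (quad c w) = - 1"
    using radical_poly_odd_root[OF assms] .
  then show ?thesis
    by (intro sum_eq_0_if_antiperiodic[of _ w]) (simp add: chi_quad_add)
qed

subsection \<open>Reduction of S to Gold sums\<close>

definition gold_sum :: "'a \<Rightarrow> int" where
  "gold_sum m = (\<Sum>x\<in>UNIV. chi n (x ^ 3 + m * x ^ 5))"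

lemma gold_sum_0: "gold_sum 0 = 0"
  using sum_chi_mult_power[of 3 1] by (simp add: gold_sum_def)

text \<open>Orthogonality in \<open>m\<close> keeps only the pairs with
  \<open>x ^ 5 = y ^ 5\<close>, that is \<open>x = y\<close>. This moment serves the injectivity of
  \<open>delta_param\<close>.\<close>

lemma sum_gold_sum_square: "(\<Sum>m\<in>UNIV. gold_sum m ^ 2) = 4 ^ n"
proof -
  have "(\<Sum>m\<in>UNIV. gold_sum m ^ 2)
      = (\<Sum>m\<in>UNIV. \<Sum>x\<in>(UNIV :: 'a set). \<Sum>y\<in>UNIV. chi n (x ^ 3 + m * x ^ 5) * chi n (y ^ 3 + m * y ^ 5))"
    by (simp add: gold_sum_def power2_eq_square sum_product)
  also have "\<dots> = (\<Sum>x\<in>(UNIV :: 'a set). \<Sum>m\<in>UNIV. \<Sum>y\<in>UNIV. chi n (x ^ 3 + m * x ^ 5) * chi n (y ^ 3 + m * y ^ 5))"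
    by (rule sum.swap)
  also have "\<dots> = (\<Sum>x\<in>(UNIV :: 'a set). \<Sum>y\<in>UNIV. \<Sum>m\<in>UNIV. chi n (x ^ 3 + m * x ^ 5) * chi n (y ^ 3 + m * y ^ 5))"
    by (intro sum.cong sum.swap refl)
  also have "\<dots> = (\<Sum>x\<in>(UNIV :: 'a set). \<Sum>y\<in>UNIV. if y = x then 2 ^ n else 0)"
  proof (intro sum.cong refl)
    fix x y :: 'a
    have "(\<Sum>m\<in>UNIV. chi n (x ^ 3 + m * x ^ 5) * chi n (y ^ 3 + m * y ^ 5))
        = chi n (x ^ 3) * chi n (y ^ 3) * (\<Sum>m\<in>UNIV. chi n (m * (x ^ 5 + y ^ 5)))"
      by (simp add: sum_distrib_left distrib_left chi_add mult_ac)
    also have "\<dots> = (if y = x then 2 ^ n else 0)"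
      using power_eq_iff[of 5 x y] by (auto simp: sum_chi_mult add_eq_0_iff_eq)
    finally show "(\<Sum>m\<in>UNIV. chi n (x ^ 3 + m * x ^ 5) * chi n (y ^ 3 + m * y ^ 5))
        = (if y = x then 2 ^ n else 0)" .
  qed
  also have "\<dots> = 4 ^ n" by (simp add: card_eq flip: power_mult_distrib)
  finally show ?thesis .
qed

definition trace_one :: "'a set" where
  "trace_one = {u. chi n u = - 1}"

text \<open>The indicator of \<open>trace_one\<close> is \<open>(1 - chi n u) / 2\<close>; doubling
  keeps everything in the integers.\<close>

lemma sum_trace_one:
  "2 * (\<Sum>u\<in>trace_one. g u) = (\<Sum>u\<in>UNIV. g u) - (\<Sum>u\<in>UNIV. chi n u * g u)"
  for g :: "'a \<Rightarrow> int"
proof -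
  have "2 * (\<Sum>u\<in>trace_one. g u) = (\<Sum>u\<in>UNIV. if u \<in> trace_one then 2 * g u else 0)"
    by (simp add: sum_distrib_left sum.If_cases)
  also have "\<dots> = (\<Sum>u\<in>UNIV. g u - chi n u * g u)"
  proof (intro sum.cong refl)
    show "(if u \<in> trace_one then 2 * g u else 0) = g u - chi n u * g u" for u
      using chi_cases[of u] by (auto simp: trace_one_def)
  qed
  finally show ?thesis by (simp add: sum_subtractf)
qed

lemma card_trace_one: "2 * int (card trace_one) = 2 ^ n"
  using sum_trace_one[of "\<lambda>_. 1"] sum_chi_mult[of 1] by (simp add: card_eq)

abbreviation delta_param :: "'a \<Rightarrow> 'a" where
  "delta_param u \<equiv> u ^ 6 + u ^ 5"

lemma delta_eq: "delta b = delta_param (b ^ 2 + b + 1)"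
  by (simp add: delta_def F_def algebra_simps numeral_eq_Suc)

lemma Delta_eq: "Delta = delta_param ` trace_one"
proof -
  have "range (\<lambda>b :: 'a. b ^ 2 + b + 1) = trace_one"
  proof (intro equalityI subsetI)
    fix u assume "u \<in> range (\<lambda>b :: 'a. b ^ 2 + b + 1)"
    then show "u \<in> trace_one" by (auto simp: trace_one_def chi_add chi_square)
  next
    fix u assume "u \<in> trace_one"
    then have "chi n (u + 1) = 1" by (simp add: trace_one_def chi_add)
    then obtain b where "b ^ 2 + b = u + 1" by (rule artin_schreier_solvable)
    then have "u = b ^ 2 + b + 1" by (simp add: add.assoc)
    then show "u \<in> range (\<lambda>b :: 'a. b ^ 2 + b + 1)" by blast
  qed
  moreover have "Delta = delta_param ` range (\<lambda>b :: 'a. b ^ 2 + b + 1)"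
    by (simp add: Delta_def delta_eq image_image)
  ultimately show ?thesis by simp
qed

lemma sum_chi_delta_param:
  assumes "m \<noteq> 0"
  shows "2 * (\<Sum>u\<in>trace_one. chi n (m ^ 6 * delta_param u)) = gold_sum m"
proof -
  have "(\<Sum>u\<in>UNIV. chi n u * chi n (m ^ 6 * delta_param u)) = 0"
    using sum_chi_quad_eq_0[of "m ^ 6"] assms by (simp add: quad_def chi_add mult.commute)
  \<comment> \<open>\<open>m ^ 6 * u ^ 6\<close> is the square of \<open>(m * u) ^ 3\<close> and so
    has the same trace as it; \<open>m ^ 6 * u ^ 5\<close> is
    \<open>m * (m * u) ^ 5\<close>.\<close>
  moreover have "chi n (m ^ 6 * delta_param u) = chi n ((m * u) ^ 3 + m * (m * u) ^ 5)" for u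
    using chi_square[of "(m * u) ^ 3"]
    by (simp add: distrib_left chi_add power_mult_distrib flip: power_mult power_Suc mult.assoc)
  ultimately show ?thesis
    using sum_scale[OF assms, of "\<lambda>v. chi n (v ^ 3 + m * v ^ 5)"]
    by (simp add: sum_trace_one gold_sum_def)
qed

text \<open>Second moments: the number of pairs with equal image, computed from the Gold sums, is
  the number of diagonal pairs.\<close>

lemma inj_on_delta_param: "inj_on delta_param trace_one"
proof -
  define A where "A = (\<lambda>c. \<Sum>u\<in>trace_one. chi n (c * delta_param u))"
  define N where "N = (\<lambda>u. card {v \<in> trace_one. delta_param v = delta_param u})"
  have "(\<Sum>c\<in>UNIV. A c ^ 2)
      = (\<Sum>c\<in>UNIV. \<Sum>u\<in>trace_one. \<Sum>v\<in>trace_one. chi n (c * delta_param u) * chi n (c * delta_param v))"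
    by (simp add: A_def power2_eq_square sum_product)
  also have "\<dots> = (\<Sum>u\<in>trace_one. \<Sum>c\<in>UNIV. \<Sum>v\<in>trace_one. chi n (c * delta_param u) * chi n (c * delta_param v))"
    by (rule sum.swap)
  also have "\<dots> = (\<Sum>u\<in>trace_one. \<Sum>v\<in>trace_one. \<Sum>c\<in>UNIV. chi n (c * delta_param u) * chi n (c * delta_param v))"
    by (intro sum.cong sum.swap refl)
  also have "\<dots> = (\<Sum>u\<in>trace_one. \<Sum>v\<in>trace_one. \<Sum>c\<in>UNIV. chi n (c * (delta_param v + delta_param u)))"
    by (simp only: distrib_left chi_add mult_ac)
  also have "\<dots> = (\<Sum>u\<in>trace_one. \<Sum>v\<in>trace_one. if delta_param v = delta_param u then 2 ^ n else 0)"
    by (simp only: sum_chi_mult add_eq_0_iff_eq)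
  also have "\<dots> = (\<Sum>u\<in>trace_one. 2 ^ n * int (N u))"
    by (intro sum.cong refl) (simp add: N_def sum.If_cases Int_def)
  also have "\<dots> = 2 ^ n * int (\<Sum>u\<in>trace_one. N u)" by (simp add: sum_distrib_left)
  finally have lhs: "(\<Sum>c\<in>UNIV. A c ^ 2) = 2 ^ n * int (\<Sum>u\<in>trace_one. N u)" .
  \<comment> \<open>At \<open>m = 0\<close> the Gold sum vanishes, but \<open>A 0\<close> is the
    size of \<open>trace_one\<close>; hence the extra term.\<close>
  have A_eq: "4 * A (m ^ 6) ^ 2 = gold_sum m ^ 2 + (if m = 0 then 4 ^ n else 0)" for m
  proof (cases "m = 0")
    case True
    have "4 * A 0 ^ 2 = (2 * int (card trace_one)) ^ 2" by (simp add: A_def power_mult_distrib)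
    also have "\<dots> = 4 ^ n" by (simp add: card_trace_one power2_eq_square flip: power_mult_distrib)
    finally show ?thesis using True by (simp add: gold_sum_0)
  next
    case False
    then have "gold_sum m = 2 * A (m ^ 6)" by (simp add: A_def sum_chi_delta_param)
    then show ?thesis using False by (simp add: power_mult_distrib)
  qed
  have "4 * (\<Sum>c\<in>UNIV. A c ^ 2) = (\<Sum>m\<in>UNIV. 4 * A (m ^ 6) ^ 2)"
    using sum_power[of 6 "\<lambda>c. 4 * A c ^ 2"] by (simp add: sum_distrib_left)
  also have "\<dots> = 2 * 4 ^ n" by (simp add: A_eq sum.distrib sum_gold_sum_square)
  finally have "4 * (2 ^ n * int (\<Sum>u\<in>trace_one. N u)) = 2 * (2 ^ n * 2 ^ n)"
    by (simp add: lhs flip: power_mult_distrib)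
  then have "int (\<Sum>u\<in>trace_one. N u) = int (card trace_one)"
    using card_trace_one by simp
  then have sum_N: "(\<Sum>u\<in>trace_one. N u) = (\<Sum>u\<in>trace_one. 1)"
    by (simp only: of_nat_eq_iff sum_constant) simp
  have N_ge: "1 \<le> N u" if "u \<in> trace_one" for u
    using that by (auto simp: N_def Suc_le_eq card_gt_0_iff)
  \<comment> \<open>Each \<open>N u\<close> is at least 1 and their sum equals the number of terms,
    so every bound is attained.\<close>
  have N_eq: "N u = 1" if "u \<in> trace_one" for u
    using sum_mono_inv[of "\<lambda>_. 1" trace_one N u] sum_N N_ge that by simp
  show ?thesis
  proof (rule inj_onI)
    fix u v assume uv: "u \<in> trace_one" "v \<in> trace_one" "delta_param u = delta_param v"
    obtain w where w: "{v' \<in> trace_one. delta_param v' = delta_param u} = {w}"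
      using N_eq[OF uv(1)] unfolding N_def by (auto simp: card_1_singleton_iff)
    have "u \<in> {w}" "v \<in> {w}" using uv unfolding w[symmetric] by simp_all
    then show "u = v" by simp
  qed
qed

text \<open>\<open>S\<close> takes each element of the image once, so injectivity of
  \<open>delta_param\<close> is what allows summing over the parameter.\<close>

lemma S_power6:
  assumes "m \<noteq> 0"
  shows "2 * S n (m ^ 6) = gold_sum m"
  unfolding S_def Delta_eq sum.reindex[OF inj_on_delta_param]
  using sum_chi_delta_param[OF assms] by simp

subsection \<open>The triple product\<close>

definition surface :: "'a \<Rightarrow> 'a \<Rightarrow> ('a \<times> 'a \<times> 'a) set" where
  "surface a b = {(x, y, z). z ^ 5 + a * x ^ 5 + b * y ^ 5 = 0}"

definition cubes :: "'a \<times> 'a \<times> 'a \<Rightarrow> 'a" where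
  "cubes = (\<lambda>(x, y, z). z ^ 3 + x ^ 3 + y ^ 3)"

lemma card_surface: "card (surface a b) = 4 ^ n"
proof -
  have "bij_betw (\<lambda>(x, y, z). (x, y)) (surface a b) UNIV"
  proof (rule bij_betw_imageI)
    show "inj_on (\<lambda>(x, y, z). (x, y)) (surface a b)"
      by (auto simp: inj_on_def surface_def add.assoc add_eq_0_iff_eq power_eq_iff)
         (metis power_eq_iff insertCI)
    have "(x, y) \<in> (\<lambda>(x, y, z). (x, y)) ` surface a b" for x y
    proof -
      have "surj (\<lambda>z :: 'a. z ^ 5)" using bij_power[of 5] by (simp add: bij_is_surj)
      then obtain z where "a * x ^ 5 + b * y ^ 5 = z ^ 5" by (rule surjE)
      then have "(x, y, z) \<in> surface a b" by (simp add: surface_def add.assoc)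
      then show ?thesis by force
    qed
    then show "(\<lambda>(x, y, z). (x, y)) ` surface a b = UNIV" by auto
  qed
  then have "card (surface a b) = card (UNIV :: ('a \<times> 'a) set)" by (rule bij_betw_same_card)
  then show ?thesis by (simp add: card_eq flip: power_mult_distrib)
qed

text \<open>The solutions are the origin and, for each root \<open>\<tau>\<close>, the
  \<open>2 ^ n - 1\<close> nonzero multiples of one point with \<open>y = 1\<close>.\<close>

lemma card_surface_cubes:
  assumes "a \<noteq> 1"
  shows "int (card {v \<in> surface a b. cubes v = 0}) = 1 + (2 ^ n - 1) * int (r a b)"
proof -
  define R where "R = {\<tau>. (a * \<tau> ^ 5 + b) ^ 3 = (\<tau> ^ 3 + 1) ^ 5}"
  define V where "V = {v \<in> surface a b. cubes v = 0}"
  have "\<exists>\<zeta>. \<zeta> ^ 3 = \<tau> ^ 3 + 1" for \<tau> :: 'a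
    using bij_power[of 3] by (metis bij_pointE insertCI)
  then obtain \<zeta> where \<zeta>: "\<And>\<tau> :: 'a. \<zeta> \<tau> ^ 3 = \<tau> ^ 3 + 1" by metis
  \<comment> \<open>The equation of \<open>r\<close> eliminates \<open>z\<close> from
    \<open>z ^ 3 = \<tau> ^ 3 + 1\<close> and \<open>z ^ 5 = a * \<tau> ^ 5 + b\<close> by comparing
    \<open>z ^ 15\<close>; injectivity of cubing makes this reversible.\<close>
  have \<zeta>5: "\<zeta> \<tau> ^ 5 = a * \<tau> ^ 5 + b \<longleftrightarrow> \<tau> \<in> R" for \<tau>
  proof -
    have "\<tau> \<in> R \<longleftrightarrow> (a * \<tau> ^ 5 + b) ^ 3 = (\<zeta> \<tau> ^ 5) ^ 3"
      unfolding R_def by (simp add: mult.commute flip: \<zeta> power_mult)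
    also have "\<dots> \<longleftrightarrow> a * \<tau> ^ 5 + b = \<zeta> \<tau> ^ 5" by (rule power_eq_iff) simp
    finally show ?thesis by auto
  qed
  have "bij_betw (\<lambda>(y, \<tau>). (y * \<tau>, y, y * \<zeta> \<tau>)) ((UNIV - {0}) \<times> R) (V - {(0, 0, 0)})"
  proof (rule bij_betw_byWitness[where f' = "\<lambda>(x, y, z). (y, x / y)"])
    have "(y * \<tau>, y, y * \<zeta> \<tau>) \<in> V" if "\<tau> \<in> R" for y \<tau>
    proof -
      have "(y * \<zeta> \<tau>) ^ 5 = a * (y * \<tau>) ^ 5 + b * y ^ 5"
        by (simp only: power_mult_distrib iffD2[OF \<zeta>5 that]) (simp add: algebra_simps)
      moreover have "(y * \<zeta> \<tau>) ^ 3 = (y * \<tau>) ^ 3 + y ^ 3"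
        by (simp only: power_mult_distrib \<zeta>) (simp add: algebra_simps)
      ultimately show ?thesis by (simp add: V_def surface_def cubes_def add.assoc)
    qed
    then show "(\<lambda>(y, \<tau>). (y * \<tau>, y, y * \<zeta> \<tau>)) ` ((UNIV - {0}) \<times> R) \<subseteq> V - {(0, 0, 0)}"
      by auto
    have "y \<noteq> 0 \<and> x / y \<in> R \<and> z = y * \<zeta> (x / y)"
      if xyz: "(x, y, z) \<in> V" "(x, y, z) \<noteq> (0, 0, 0)" for x y z
    proof -
      have five: "z ^ 5 = a * x ^ 5 + b * y ^ 5" and three: "z ^ 3 = x ^ 3 + y ^ 3"
        using xyz by (auto simp: V_def surface_def cubes_def add.assoc add_eq_0_iff_eq)
      \<comment> \<open>At \<open>y = 0\<close> the cubic gives \<open>z = x\<close>, and the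
        quintic then \<open>(1 + a) * x ^ 5 = 0\<close>; this is where \<open>a \<noteq> 1\<close>
        enters.\<close>
      have y0: "y \<noteq> 0"
      proof
        assume "y = 0"
        then have "z = x" using three power_eq_iff[of 3] by auto
        then have "x = 0" using five assms \<open>y = 0\<close> by simp
        with \<open>y = 0\<close> \<open>z = x\<close> xyz show False by simp
      qed
      have "(z / y) ^ 3 = \<zeta> (x / y) ^ 3"
        using y0 three by (simp add: \<zeta> power_divide add_divide_distrib)
      then have z: "z / y = \<zeta> (x / y)" by (simp add: power_eq_iff)
      have "(z / y) ^ 5 = a * (x / y) ^ 5 + b"
        using y0 five by (simp add: power_divide add_divide_distrib)
      then have "x / y \<in> R" by (simp only: z \<zeta>5)
      moreover have "z = y * \<zeta> (x / y)" using y0 by (simp flip: z)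
      ultimately show ?thesis using y0 by simp
    qed
    note inverse = this
    show "\<forall>v\<in>V - {(0, 0, 0)}. (\<lambda>(y, \<tau>). (y * \<tau>, y, y * \<zeta> \<tau>)) ((\<lambda>(x, y, z). (y, x / y)) v) = v"
      using inverse by fastforce
    show "(\<lambda>(x, y, z). (y, x / y)) ` (V - {(0, 0, 0)}) \<subseteq> (UNIV - {0}) \<times> R"
      using inverse by fastforce
  qed auto
  then have "card (V - {(0, 0, 0)}) = card ((UNIV - {0 :: 'a}) \<times> R)"
    by (simp add: bij_betw_same_card)
  also have "\<dots> = (2 ^ n - 1) * r a b"
    by (simp add: card_cartesian_product card_Diff_singleton card_eq r_def R_def)
  finally have "card (V - {(0, 0, 0)}) = (2 ^ n - 1) * r a b" .
  moreover have "(0, 0, 0) \<in> V" by (simp add: V_def surface_def cubes_def)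
  ultimately have "card V = 1 + (2 ^ n - 1) * r a b"
    by (metis card.remove finite plus_1_eq_Suc)
  then show ?thesis by (simp add: V_def of_nat_diff)
qed

text \<open>Scaling by \<open>s\<close> preserves the cone and multiplies \<open>cubes\<close> by
  \<open>s ^ 3\<close>. Summed over nonzero \<open>s\<close>, a point contributes
  \<open>2 ^ n - 1\<close> if \<open>cubes\<close> vanishes there and -1 otherwise.\<close>

lemma sum_chi_cubes:
  assumes "a \<noteq> 1"
  shows "(\<Sum>v\<in>surface a b. chi n (cubes v)) = 2 ^ n * (int (r a b) - 1)"
proof -
  define E where "E = (\<Sum>v\<in>surface a b. chi n (cubes v))"
  have scale: "(\<Sum>v\<in>surface a b. chi n (s ^ 3 * cubes v)) = E" if "s \<noteq> 0" for s
    unfolding E_def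
  proof (rule sum.reindex_bij_witness[of _ "\<lambda>(x, y, z). (x / s, y / s, z / s)" "\<lambda>(x, y, z). (s * x, s * y, s * z)"])
    have homogeneous: "(s * x, s * y, s * z) \<in> surface a b \<longleftrightarrow> (x, y, z) \<in> surface a b"
      if "s \<noteq> 0" for s x y z
    proof -
      have "(s * z) ^ 5 + a * (s * x) ^ 5 + b * (s * y) ^ 5 = s ^ 5 * (z ^ 5 + a * x ^ 5 + b * y ^ 5)"
        by (simp add: power_mult_distrib algebra_simps)
      then show ?thesis using that by (simp add: surface_def)
    qed
    show "(case v of (x, y, z) \<Rightarrow> (s * x, s * y, s * z)) \<in> surface a b" if "v \<in> surface a b" for v
      using that homogeneous[OF \<open>s \<noteq> 0\<close>] by (cases v) simp
    show "(case v of (x, y, z) \<Rightarrow> (x / s, y / s, z / s)) \<in> surface a b" if "v \<in> surface a b" for v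
      using that homogeneous[of "1 / s"] \<open>s \<noteq> 0\<close> by (cases v) simp
    show "chi n (cubes (case v of (x, y, z) \<Rightarrow> (s * x, s * y, s * z))) = chi n (s ^ 3 * cubes v)" for v
      by (cases v) (simp add: cubes_def power_mult_distrib distrib_left)
  qed (use that in auto)
  have "(2 ^ n - 1) * E = (\<Sum>s\<in>UNIV - {0}. \<Sum>v\<in>surface a b. chi n (s ^ 3 * cubes v))"
    by (simp add: scale card_Diff_singleton card_eq of_nat_diff)
  also have "\<dots> = (\<Sum>v\<in>surface a b. \<Sum>s\<in>UNIV - {0}. chi n (s ^ 3 * cubes v))"
    by (rule sum.swap)
  also have "\<dots> = (\<Sum>v\<in>surface a b. (if cubes v = 0 then 2 ^ n else 0) - 1)"
    by (simp add: sum_diff1 sum_chi_mult_power)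
  also have "\<dots> = 2 ^ n * int (card {v \<in> surface a b. cubes v = 0}) - 4 ^ n"
    by (simp add: sum_subtractf sum.If_cases card_surface Int_def)
  also have "\<dots> = (2 ^ n - 1) * (2 ^ n * (int (r a b) - 1))"
    unfolding card_surface_cubes[OF assms]
    by (simp add: algebra_simps flip: power_mult_distrib)
  finally have "(2 ^ n - 1) * E = (2 ^ n - 1) * (2 ^ n * (int (r a b) - 1))" .
  moreover have "(2 :: int) ^ n \<noteq> 1" using one_less_power[of "2 :: int" n] n_pos by simp
  ultimately show ?thesis by (simp add: E_def)
qed

lemma sum_gold_sum_product:
  assumes "a \<noteq> 1"
  shows "(\<Sum>m\<in>UNIV. gold_sum m * gold_sum (m * a) * gold_sum (m * b)) = 4 ^ n * (int (r a b) - 1)"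
proof -
  have triple: "gold_sum m * gold_sum (m * a) * gold_sum (m * b)
      = (\<Sum>(x, y, z)\<in>UNIV. chi n (cubes (x, y, z)) * chi n (m * (z ^ 5 + a * x ^ 5 + b * y ^ 5)))"
    (is "_ = ?rhs") for m
  proof -
    have "gold_sum m * gold_sum (m * a) * gold_sum (m * b)
      = gold_sum (m * a) * (gold_sum (m * b) * gold_sum m)" by simp
    also have "\<dots> = (\<Sum>x\<in>UNIV. \<Sum>y\<in>UNIV. \<Sum>z\<in>UNIV. chi n (x ^ 3 + m * a * x ^ 5)
        * (chi n (y ^ 3 + m * b * y ^ 5) * chi n (z ^ 3 + m * z ^ 5)))"
      unfolding gold_sum_def sum_product by (simp only: sum_distrib_left sum_distrib_right)
    also have "\<dots> = (\<Sum>x\<in>UNIV. \<Sum>y\<in>UNIV. \<Sum>z\<in>UNIV.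
        chi n (cubes (x, y, z)) * chi n (m * (z ^ 5 + a * x ^ 5 + b * y ^ 5)))"
      by (intro sum.cong refl) (simp add: cubes_def algebra_simps flip: chi_add)
    also have "\<dots> = ?rhs" by (simp add: sum.cartesian_product)
    finally show ?thesis .
  qed
  have "(\<Sum>m\<in>UNIV. gold_sum m * gold_sum (m * a) * gold_sum (m * b))
      = (\<Sum>(x, y, z)\<in>UNIV. \<Sum>m\<in>UNIV.
          chi n (cubes (x, y, z)) * chi n (m * (z ^ 5 + a * x ^ 5 + b * y ^ 5)))"
    unfolding triple by (subst sum.swap) (simp add: case_prod_unfold)
  also have "\<dots> = (\<Sum>v\<in>UNIV. if v \<in> surface a b then 2 ^ n * chi n (cubes v) else 0)"
    by (intro sum.cong refl) (auto simp: surface_def sum_chi_mult simp flip: sum_distrib_left)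
  also have "\<dots> = 2 ^ n * (\<Sum>v\<in>surface a b. chi n (cubes v))"
    by (simp add: sum.If_cases sum_distrib_left)
  finally show ?thesis
    by (simp add: sum_chi_cubes[OF assms] flip: power_mult_distrib mult.assoc)
qed

section \<open>Sixth roots and the evaluation of \<open>Z\<close>\<close>

lemma root6_power6: "root6 x ^ 6 = (x :: 'a)"
  unfolding root6_def using bij_power[of 6] by (simp add: bij_is_surj surj_f_inv_f[of "\<lambda>x :: 'a. x ^ 6"])

lemma root6_eqI: "a ^ 6 = x \<Longrightarrow> root6 x = (a :: 'a)"
  using root6_power6[of x] by (auto simp: power_eq_iff)

lemma root6_notin:
  assumes "x \<notin> {0, 1}"
  shows "root6 x \<notin> {0, 1 :: 'a}"
  using root6_power6[of x] assms by auto

text \<open>Substituting \<open>l = m ^ 6\<close> turns each \<open>S\<close> into half a Gold sum,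
  whence the factor 8.\<close>

lemma Z_eq:
  assumes a: "a \<notin> {0, 1 :: 'a}" and b: "b \<notin> {0, 1}" and ab: "a ^ 6 + b ^ 6 = 1"
  shows "8 * Z n (a ^ 6) = 4 ^ n * (int (r a b) - 1)"
proof -
  have b6: "1 + a ^ 6 = b ^ 6" by (simp flip: ab)
  have "Z n (a ^ 6) = (\<Sum>l\<in>UNIV - {0}. S n l * S n (l * a ^ 6) * S n (l * b ^ 6))"
    by (simp add: Z_def b6)
  also have "\<dots> = (\<Sum>m\<in>UNIV - {0}. S n (m ^ 6) * S n (m ^ 6 * a ^ 6) * S n (m ^ 6 * b ^ 6))"
  proof (rule sum.reindex_bij_betw[symmetric])
    have "(\<lambda>m :: 'a. m ^ 6) ` (UNIV - {0}) = UNIV - {0}"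
      using bij_power[of 6] by (simp add: image_set_diff bij_is_inj bij_is_surj)
    then show "bij_betw (\<lambda>m :: 'a. m ^ 6) (UNIV - {0}) (UNIV - {0})"
      using inj_power[of 6] inj_on_subset[OF _ subset_UNIV] by (auto simp: bij_betw_def)
  qed
  finally have "8 * Z n (a ^ 6)
      = (\<Sum>m\<in>UNIV - {0}. (2 * S n (m ^ 6)) * (2 * S n ((m * a) ^ 6)) * (2 * S n ((m * b) ^ 6)))"
    by (simp add: sum_distrib_left power_mult_distrib mult_ac)
  also have "\<dots> = (\<Sum>m\<in>UNIV - {0}. gold_sum m * gold_sum (m * a) * gold_sum (m * b))"
    using a b by (intro sum.cong refl) (simp add: S_power6)
  \<comment> \<open>The term at \<open>m = 0\<close> may be added because
    \<open>gold_sum 0 = 0\<close>.\<close>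
  also have "\<dots> = (\<Sum>m\<in>UNIV. gold_sum m * gold_sum (m * a) * gold_sum (m * b))"
    by (simp add: sum_diff1 gold_sum_0)
  finally show ?thesis using a by (simp add: sum_gold_sum_product)
qed

text \<open>A field with two elements has no such \<open>\<rho>\<close>. The bound keeps the natural
  subtraction \<open>2 * n - 3\<close> from truncating.\<close>

lemma n_ge_3:
  assumes "\<rho> \<notin> {0, 1 :: 'a}"
  shows "n \<ge> 3"
proof (rule ccontr)
  assume "\<not> n \<ge> 3"
  then have "n = 1" using odd_n by (cases n) (auto simp: numeral_eq_Suc le_Suc_eq not_le less_Suc_eq)
  then have "card (UNIV :: 'a set) = card {0, 1 :: 'a}" by (simp add: card_eq)
  then have "{0, 1} = (UNIV :: 'a set)" by (intro card_subset_eq) auto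
  then show False using assms by blast
qed

lemma Z_root6:
  assumes "\<rho> \<notin> {0, 1 :: 'a}" and "a = root6 \<rho>" and "b = root6 (1 + \<rho>)"
  shows "a \<notin> {0, 1} \<and> b \<notin> {0, 1} \<and> a ^ 6 + b ^ 6 = 1 \<and>
    Z n \<rho> = 2 ^ (2 * n - 3) * (int (r a b) - 1)"
proof -
  have "1 + \<rho> \<noteq> 0" using assms(1) unfolding add_eq_0_iff_eq by blast
  then have \<sigma>: "1 + \<rho> \<notin> {0, 1}" using assms(1) by simp
  have ab: "a \<notin> {0, 1}" "b \<notin> {0, 1}"
    unfolding assms(2,3) by (rule root6_notin[OF assms(1)], rule root6_notin[OF \<sigma>])
  have pows: "a ^ 6 = \<rho>" "b ^ 6 = 1 + \<rho>" by (simp_all add: assms(2,3) root6_power6)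
  have "\<rho> + (1 + \<rho>) = 1" by (simp add: add.left_commute)
  then have sum: "a ^ 6 + b ^ 6 = 1" by (simp only: pows)
  have "2 * n - 3 + 3 = 2 * n" using n_ge_3[OF assms(1)] by simp
  then have "(2 :: int) ^ (2 * n) = 2 ^ (2 * n - 3) * 2 ^ 3"
    using power_add[of "2 :: int" "2 * n - 3" 3] by simp
  then have "(4 :: int) ^ n = 8 * 2 ^ (2 * n - 3)" by (simp add: power_mult)
  moreover have "8 * Z n \<rho> = 4 ^ n * (int (r a b) - 1)"
    using Z_eq[OF ab sum] by (simp only: pows)
  ultimately have "Z n \<rho> = 2 ^ (2 * n - 3) * (int (r a b) - 1)" by simp
  then show ?thesis using ab sum by blast
qed

text \<open>The first coordinate determines \<open>\<rho>\<close> as \<open>a ^ 6\<close>, and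
  \<open>b\<close> is then the only sixth root of \<open>1 + a ^ 6\<close>.\<close>

lemma bij_betw_root6:
  "bij_betw (\<lambda>\<rho> :: 'a. (root6 \<rho>, root6 (1 + \<rho>))) (UNIV - {0, 1})
     {(a, b). a \<notin> {0, 1} \<and> b \<notin> {0, 1} \<and> a ^ 6 + b ^ 6 = 1}"
proof (rule bij_betw_byWitness[where f' = "\<lambda>(a, b). a ^ 6"])
  have "root6 (1 + a ^ 6) = b" if "a ^ 6 + b ^ 6 = 1" for a b :: 'a
    by (rule root6_eqI) (simp flip: that)
  then show "\<forall>p\<in>{(a, b). a \<notin> {0, 1} \<and> b \<notin> {0, 1} \<and> a ^ 6 + b ^ 6 = 1}.
      (\<lambda>\<rho> :: 'a. (root6 \<rho>, root6 (1 + \<rho>))) ((\<lambda>(a, b). a ^ 6) p) = p"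
    using root6_eqI[OF refl] by auto
  show "(\<lambda>\<rho> :: 'a. (root6 \<rho>, root6 (1 + \<rho>))) ` (UNIV - {0, 1})
      \<subseteq> {(a, b). a \<notin> {0, 1} \<and> b \<notin> {0, 1} \<and> a ^ 6 + b ^ 6 = 1}"
    using Z_root6[OF _ refl refl] by (intro image_subsetI) simp
  have "a ^ 6 \<notin> {0, 1}" if "a \<notin> {0, 1}" for a :: 'a
    using that power_eq_iff[of 6 a 1] by simp
  then show "(\<lambda>(a, b). a ^ 6) ` {(a, b). a \<notin> {0, 1} \<and> b \<notin> {0, 1} \<and> a ^ 6 + b ^ 6 = 1}
      \<subseteq> UNIV - {0, 1 :: 'a}"
    by auto
qed (simp add: root6_power6)

end

theorem theorem11p9:
  fixes n :: nat
  assumes "CARD('a :: {field, finite}) = 2 ^ n" and "odd n"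
  shows "(\<forall>\<rho> :: 'a. \<rho> \<notin> {0, 1} \<longrightarrow>
            (let \<sigma> = 1 + \<rho>; a = root6 \<rho>; b = root6 \<sigma> in
               a \<notin> {0, 1} \<and> b \<notin> {0, 1} \<and> a ^ 6 + b ^ 6 = 1 \<and>
               Z n \<rho> = 2 ^ (2 * n - 3) * (int (r a b) - 1)))
         \<and> bij_betw (\<lambda>\<rho> :: 'a. (root6 \<rho>, root6 (1 + \<rho>))) (UNIV - {0, 1})
             {(a, b). a \<notin> {0, 1} \<and> b \<notin> {0, 1} \<and> a ^ 6 + b ^ 6 = 1}"
proof -
  interpret odd_binary_field n "TYPE('a)"
    using assms by unfold_locales
  show ?thesis
    unfolding Let_def using Z_root6[OF _ refl refl] bij_betw_root6 by (intro conjI allI impI) simp_all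
qed

end
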